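(* Let $q\in(0,1)$ and let $F_X$ be a proper cumulative distribution function (CDF) on $\mathbb{R}$. Then the equation $$H=q\,\mathbf{1}_{\mathbb{R}_+}+(1-q)\,K(H),\qquad K(H)(x)=(H*F_X)(x)\,\mathbf{1}_{\mathbb{R}_+}(x),$$ has a unique bounded solution $H:\mathbb{R}\to\mathbb{R}$. Moreover, let $F_{W^R}$ be the CDF of the stationary distribution of the GI/GI/1 waiting-time chain with resetting defined in the context. Both $F_{W^R}$ and the CDF defined by the series $\sum_{j=0}^\infty q(1-q)^jK^j(\mathbf{1}_{\mathbb{R}_+})$ satisfy this equation, hence they coincide: $$F_{W^R}=\sum_{j=0}^\infty q(1-q)^jK^j(\mathbf{1}_{\mathbb{R}_+})=q\mathbf{1}_{\mathbb{R}_+}+q(1-q)F_X\mathbf{1}_{\mathbb{R}_+}+q(1-q)^2\big(F_X*(F_X\mathbf{1}_{\mathbb{R}_+})\big)\mathbf{1}_{\mathbb{R}_+}+q(1-q)^3\big(F_X*((F_X*(F_X\mathbf{1}_{\mathbb{R}_+}))\mathbf{1}_{\mathbb{R}_+})\big)\mathbf{1}_{\mathbb{R}_+}+\cdots .$$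
   Context: $\mathbb{R}_+=[0,\infty)$ and $Y^+=\max(0,Y)$. A CDF $F$ is proper if $F(x)\to0$ as $x\to-\infty$ and $F(x)\to1$ as $x\to\infty$. For a bounded Borel function $H$ (in particular a CDF), $(H*F_X)(t)=\int_{\mathbb{R}}H(t-y)\,dF_X(y)$. $K$ maps proper CDFs to proper CDFs; $K^j$ is its $j$-fold composition and $K^0$ is the identity. "Bounded solution" means a bounded Borel function on $\mathbb{R}$ satisfying the equation pointwise. The GI/GI/1 waiting-time chain with resetting is the discrete-time Markov chain $\{W^R_n\}_{n\ge0}$ on $\mathbb{R}_+$ given by $W^R_{n+1}=Z_{n+1}(W^R_n+X_n)^+$, where $\{X_n\}_{n\ge0}$ are i.i.d. with CDF $F_X$ ($X_n=V_n-U_n$, service time minus inter-arrival time), $\{Z_n\}_{n\ge1}$ are i.i.d. Bernoulli with $\mathbb{P}(Z_n=0)=q=1-\mathbb{P}(Z_n=1)$, and $W_0^R\ge0$, $\{X_n\}$, $\{Z_n\}$ are independent. This chain has a unique stationary distribution, with CDF $F_{W^R}$. *)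

theory Defs
  imports "HOL-Probability.Probability"
begin

definition proper_cdf :: "(real \<Rightarrow> real) \<Rightarrow> bool" where
  "proper_cdf F \<longleftrightarrow> mono F \<and> (\<forall>a. continuous (at_right a) F) \<and>
     (F \<longlongrightarrow> 0) at_bot \<and> (F \<longlongrightarrow> 1) at_top"

text \<open>\<open>H * G\<close> for a bounded Borel function \<open>H\<close> and a proper CDF \<open>G\<close>; \<open>dG\<close> is the
  Lebesgue--Stieltjes measure of \<open>G\<close>.\<close>

definition cdf_conv :: "(real \<Rightarrow> real) \<Rightarrow> (real \<Rightarrow> real) \<Rightarrow> real \<Rightarrow> real" where
  "cdf_conv H G t = (LINT y|interval_measure G. H (t - y))"

definition K_op :: "(real \<Rightarrow> real) \<Rightarrow> (real \<Rightarrow> real) \<Rightarrow> real \<Rightarrow> real" where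
  "K_op F H = (\<lambda>x. cdf_conv H F x * indicator {0..} x)"

definition bounded_solution :: "real \<Rightarrow> (real \<Rightarrow> real) \<Rightarrow> (real \<Rightarrow> real) \<Rightarrow> bool" where
  "bounded_solution q F H \<longleftrightarrow> H \<in> borel_measurable borel \<and> bounded (range H) \<and>
     (\<forall>x. H x = q * indicator {0..} x + (1 - q) * K_op F H x)"

definition series_cdf :: "real \<Rightarrow> (real \<Rightarrow> real) \<Rightarrow> real \<Rightarrow> real" where
  "series_cdf q F x = (\<Sum>j. q * (1 - q) ^ j * (K_op F ^^ j) (indicator {0..}) x)"

text \<open>The factors \<open>1\<close>, \<open>F 1\<close>, \<open>(F * (F 1)) 1\<close>, \<open>(F * ((F * (F 1)) 1)) 1\<close>, ... of the written-out
  series, where \<open>1\<close> is the indicator function of \<open>[0, \<infinity>)\<close>. As displayed, \<open>F\<close> is the left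
  factor of each convolution, i.e. the integration is against the previous factor (which is a
  proper CDF), whereas \<^const>\<open>K_op\<close> integrates against \<open>F\<close>.\<close>

fun expansion_factor :: "(real \<Rightarrow> real) \<Rightarrow> nat \<Rightarrow> real \<Rightarrow> real" where
  "expansion_factor F 0 = indicator {0..}"
| "expansion_factor F (Suc 0) = (\<lambda>x. F x * indicator {0..} x)"
| "expansion_factor F (Suc (Suc j)) =
     (\<lambda>x. cdf_conv F (expansion_factor F (Suc j)) x * indicator {0..} x)"

datatype chain_input = Initial | Increment nat | Reset nat

text \<open>The variable \<open>Z 0\<close> plays no role; the resetting variables are \<open>Z 1, Z 2, ...\<close>.\<close>

locale resetting_waiting_chain = prob_space M
  for M :: "'a measure" and q :: real and F :: "real \<Rightarrow> real"
    and W X Z :: "nat \<Rightarrow> 'a \<Rightarrow> real" +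
  assumes indep: "indep_vars (\<lambda>_. borel)
      (\<lambda>i. case i of Initial \<Rightarrow> W 0 | Increment n \<Rightarrow> X n | Reset n \<Rightarrow> Z n)
      ({Initial} \<union> range Increment \<union> Reset ` {1..})"
    and initial_nonneg: "\<omega> \<in> space M \<Longrightarrow> 0 \<le> W 0 \<omega>"
    and increment_cdf: "cdf (distr M borel (X n)) = F"
    and reset_prob_0: "1 \<le> n \<Longrightarrow> prob {\<omega> \<in> space M. Z n \<omega> = 0} = q"
    and reset_prob_1: "1 \<le> n \<Longrightarrow> prob {\<omega> \<in> space M. Z n \<omega> = 1} = 1 - q"
    and step: "\<omega> \<in> space M \<Longrightarrow> W (Suc n) \<omega> = Z (Suc n) \<omega> * max 0 (W n \<omega> + X n \<omega>)"

text \<open>The law of the next state when the current state is \<open>w\<close>. By the i.i.d. assumptions the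
  first step determines the kernel of the chain.\<close>

definition transition_law ::
  "'a measure \<Rightarrow> (nat \<Rightarrow> 'a \<Rightarrow> real) \<Rightarrow> (nat \<Rightarrow> 'a \<Rightarrow> real) \<Rightarrow> real \<Rightarrow> real measure" where
  "transition_law M X Z w = distr M borel (\<lambda>\<omega>. Z 1 \<omega> * max 0 (w + X 0 \<omega>))"

text \<open>Distributions on the state space \<open>[0, \<infinity>)\<close> are represented as Borel probability measures on
  the real line giving \<open>[0, \<infinity>)\<close> full mass.\<close>

definition stationary_distribution ::
  "'a measure \<Rightarrow> (nat \<Rightarrow> 'a \<Rightarrow> real) \<Rightarrow> (nat \<Rightarrow> 'a \<Rightarrow> real) \<Rightarrow> real measure \<Rightarrow> bool" where
  "stationary_distribution M X Z \<mu> \<longleftrightarrow> real_distribution \<mu> \<and> measure \<mu> {0..} = 1 \<and>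
     (\<forall>A\<in>sets borel. emeasure \<mu> A = (\<integral>\<^sup>+ w. emeasure (transition_law M X Z w) A \<partial>\<mu>))"

end

theory Submission
  imports Defs
begin

text \<open>
  The operator \<open>K\<close> does not increase the supremum norm and enters with the factor \<open>1 - q\<close>, so
  two bounded solutions differ by at most \<open>(1 - q)\<^sup>n\<close> times a constant for every \<open>n\<close>. If \<open>H\<close> is the
  CDF of \<open>\<mu>\<close>, then \<open>K H\<close> is the CDF of \<open>max 0 (w + X)\<close> with \<open>w\<close> distributed as \<open>\<mu>\<close> and \<open>X\<close> as \<open>F\<close>,
  independently; hence all terms \<open>K\<^sup>j 1\<close> are proper CDFs, and commutativity of convolution lets the
  two factors be exchanged in the written-out series. Monotonicity, right-continuity and the limits
  pass to the geometric mixture by dominated convergence of series, and applying \<open>K\<close> termwise shifts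
  its index. Finally, one step of the chain turns the CDF \<open>H\<close> of the current state into
  \<open>q 1 + (1 - q) K H\<close>, and a distribution is determined by its CDF, so the stationary distributions
  are precisely the laws on \<open>[0, \<infinity>)\<close> whose CDF solves the equation.
\<close>

section \<open>Proper CDFs and convolution\<close>

lemma proper_cdf_cdf:
  assumes "real_distribution \<mu>"
  shows "proper_cdf (cdf \<mu>)"
proof -
  interpret real_distribution \<mu> by fact
  show ?thesis
    unfolding proper_cdf_def mono_def
    using cdf_nondecreasing cdf_is_right_cont cdf_lim_at_bot cdf_lim_at_top_prob by blast
qed

lemma real_distribution_proper_cdf:
  assumes "proper_cdf F"
  shows "real_distribution (interval_measure F)"
  using assms unfolding proper_cdf_def
  by (intro real_distribution_interval_measure) (auto dest: monoD)

lemma cdf_interval_measure_proper_cdf: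
  assumes "proper_cdf F"
  shows "cdf (interval_measure F) = F"
  using assms unfolding proper_cdf_def
  by (intro cdf_interval_measure) (auto dest: monoD)

text \<open>Both measures have the same CDF. This turns integrals against the Stieltjes measure of
  \<open>cdf \<mu>\<close> into integrals against \<open>\<mu>\<close>.\<close>

lemma interval_measure_cdf:
  assumes "real_distribution \<mu>"
  shows "interval_measure (cdf \<mu>) = \<mu>"
  using assms proper_cdf_cdf[OF assms]
  by (intro cdf_unique real_distribution_proper_cdf cdf_interval_measure_proper_cdf)

lemma proper_cdf_bounds:
  assumes "proper_cdf F"
  shows proper_cdf_nonneg: "0 \<le> F x" and proper_cdf_le_1: "F x \<le> 1"
proof -
  interpret real_distribution "interval_measure F"
    by (rule real_distribution_proper_cdf[OF assms])
  show "0 \<le> F x" "F x \<le> 1"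
    using cdf_nonneg[of x] cdf_bounded_prob[of x]
    by (simp_all add: cdf_interval_measure_proper_cdf[OF assms])
qed

lemma abs_proper_cdf_le_1: "proper_cdf F \<Longrightarrow> \<bar>F x\<bar> \<le> 1"
  using proper_cdf_bounds[of F x] by simp

lemma borel_measurable_proper_cdf:
  assumes "proper_cdf F"
  shows "F \<in> borel_measurable borel"
  using assms unfolding proper_cdf_def by (intro borel_measurable_mono) simp

text \<open>The starting function of the iteration is thus the CDF of the point mass at 0, the
  neutral element of convolution.\<close>

lemma cdf_return_0: "cdf (return borel 0) = (indicator {0..} :: real \<Rightarrow> real)"
  by (auto simp: cdf_def measure_return fun_eq_iff split: split_indicator)

lemma real_distribution_return: "real_distribution (return borel (0::real))"
  by (simp add: real_distribution_def real_distribution_axioms_def prob_space_return)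

lemma proper_cdf_indicator: "proper_cdf (indicator {0..})"
  using proper_cdf_cdf[OF real_distribution_return] by (simp add: cdf_return_0)

lemma real_distribution_convolution:
  assumes "real_distribution \<mu>" "real_distribution \<nu>"
  shows "real_distribution (\<mu> \<star> \<nu>)"
proof -
  interpret \<mu>: real_distribution \<mu> by fact
  interpret \<nu>: real_distribution \<nu> by fact
  interpret pair_prob_space \<mu> \<nu> ..
  show ?thesis
    unfolding convolution_def by (rule P.real_distribution_distr) measurable
qed

text \<open>Conditioning on the first summand \<open>w\<close> leaves the event that the second is
  at most \<open>x - w\<close>.\<close>

lemma cdf_convolution:
  assumes "real_distribution \<mu>" "real_distribution \<nu>"
  shows "cdf (\<mu> \<star> \<nu>) x = (LINT w|\<mu>. cdf \<nu> (x - w))"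
proof -
  interpret \<mu>: real_distribution \<mu> by fact
  interpret \<nu>: real_distribution \<nu> by fact
  interpret C: real_distribution "\<mu> \<star> \<nu>" by (intro real_distribution_convolution assms)
  note [measurable] = borel_measurable_proper_cdf[OF proper_cdf_cdf[OF assms(2)]]
  have shift: "{a. a + w \<in> {..x}} = {..x - w}" for w :: real by auto
  have "ennreal (cdf (\<mu> \<star> \<nu>) x) = emeasure (\<mu> \<star> \<nu>) {..x}"
    by (simp add: cdf_def C.emeasure_eq_measure)
  also have "\<dots> = (\<integral>\<^sup>+w. (emeasure \<nu> {a. a + w \<in> {..x}}) \<partial>\<mu>)"
    by (rule convolution_emeasure) (simp_all add: \<mu>.finite_measure_axioms \<nu>.finite_measure_axioms)
  also have "\<dots> = (\<integral>\<^sup>+w. ennreal (cdf \<nu> (x - w)) \<partial>\<mu>)"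
    unfolding shift by (simp add: cdf_def \<nu>.emeasure_eq_measure)
  also have "\<dots> = ennreal (LINT w|\<mu>. cdf \<nu> (x - w))"
    by (intro nn_integral_eq_integral \<mu>.integrable_const_bound[where B=1])
       (auto simp: \<nu>.cdf_nonneg \<nu>.cdf_bounded_prob)
  finally show ?thesis
    by (subst (asm) ennreal_inj) (auto simp: C.cdf_nonneg \<nu>.cdf_nonneg intro!: integral_nonneg_AE)
qed

text \<open>The integral defining \<open>cdf_conv F G\<close> runs over the law of \<open>G\<close>,
  so it is directly the CDF of \<open>?G \<star> ?F\<close>; commutativity of measure convolution
  restores the order.\<close>

lemma cdf_conv_eq_cdf_convolution:
  assumes "proper_cdf F" "proper_cdf G"
  shows "cdf_conv F G = cdf (interval_measure F \<star> interval_measure G)"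
proof -
  let ?F = "interval_measure F" and ?G = "interval_measure G"
  interpret F: real_distribution ?F by (rule real_distribution_proper_cdf[OF assms(1)])
  interpret G: real_distribution ?G by (rule real_distribution_proper_cdf[OF assms(2)])
  have "(?F \<star> ?G) = (?G \<star> ?F)"
    by (rule convolution_commutative) (simp_all add: F.finite_measure_axioms G.finite_measure_axioms)
  moreover have "cdf (?G \<star> ?F) = cdf_conv F G"
    by (rule ext) (simp add: cdf_convolution F.real_distribution_axioms G.real_distribution_axioms
        cdf_conv_def cdf_interval_measure_proper_cdf[OF assms(1)])
  ultimately show ?thesis by simp
qed

lemma cdf_conv_commute:
  assumes "proper_cdf F" "proper_cdf G"
  shows "cdf_conv F G = cdf_conv G F"
proof -
  interpret F: real_distribution "interval_measure F" by (rule real_distribution_proper_cdf[OF assms(1)])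
  interpret G: real_distribution "interval_measure G" by (rule real_distribution_proper_cdf[OF assms(2)])
  show ?thesis
    using convolution_commutative[of "interval_measure F" "interval_measure G"]
    by (simp add: cdf_conv_eq_cdf_convolution assms F.finite_measure_axioms G.finite_measure_axioms)
qed

section \<open>The operator \<open>K\<close>\<close>

text \<open>Multiplying a CDF by the indicator of the nonnegative reals amounts to pushing the law
  forward along \<open>max 0\<close>, so \<open>K_op F H\<close> is again the CDF of a probability
  law.\<close>

lemma proper_cdf_K_op:
  assumes "proper_cdf F" "proper_cdf H"
  shows "proper_cdf (K_op F H)"
proof -
  let ?C = "interval_measure H \<star> interval_measure F"
  interpret real_distribution ?C
    by (intro real_distribution_convolution real_distribution_proper_cdf assms)
  have "cdf (distr ?C borel (max 0)) x = K_op F H x" for x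
  proof -
    have "cdf (distr ?C borel (max 0)) x = measure ?C (max 0 -` {..x})"
      by (simp add: cdf_def measure_distr)
    also have "max 0 -` {..x} = (if 0 \<le> x then {..x} else {})" by auto
    finally show ?thesis
      by (simp add: K_op_def cdf_conv_eq_cdf_convolution assms cdf_def)
  qed
  moreover have "real_distribution (distr ?C borel (max 0))" by simp
  ultimately show ?thesis
    using proper_cdf_cdf[of "distr ?C borel (max 0)"] by presburger
qed

lemma proper_cdf_K_op_power:
  assumes "proper_cdf F"
  shows "proper_cdf ((K_op F ^^ j) (indicator {0..}))"
  by (induction j) (auto simp: proper_cdf_indicator proper_cdf_K_op[OF assms])

lemma expansion_factor_eq:
  assumes "proper_cdf F"
  shows "expansion_factor F j = (K_op F ^^ j) (indicator {0..})"
  using assms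
proof (induction F j rule: expansion_factor.induct)
  case (2 F)
  \<comment> \<open>The first factor is \<open>F\<close> itself rather than a convolution; it agrees
    with the recursion because integrating against the point mass at 0 returns
    \<open>F x\<close>.\<close>
  have "interval_measure (indicator {0..}) = return borel (0::real)"
    using interval_measure_cdf[OF real_distribution_return] by (simp add: cdf_return_0)
  then have "cdf_conv F (indicator {0..}) x = F x" for x
    using borel_measurable_proper_cdf[OF 2] by (simp add: cdf_conv_def integral_return)
  then show ?case
    by (simp add: K_op_def cdf_conv_commute[OF proper_cdf_indicator 2])
next
  case (3 F j)
  then show ?case
    using cdf_conv_commute[OF 3(2) proper_cdf_K_op_power[OF 3(2), of "Suc j"]]
    by (simp add: K_op_def[of F "K_op F _"])
qed simp

lemma integrable_bounded_borel:
  fixes H :: "real \<Rightarrow> real"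
  assumes "proper_cdf F" and [measurable]: "H \<in> borel_measurable borel" and "\<And>x. \<bar>H x\<bar> \<le> C"
  shows "integrable (interval_measure F) (\<lambda>y. H (x - y))"
proof -
  interpret real_distribution "interval_measure F"
    by (rule real_distribution_proper_cdf[OF assms(1)])
  show ?thesis
    using assms(3) by (intro integrable_const_bound[where B=C]) auto
qed

text \<open>An average under a probability measure stays within the bounds of the integrand, and the
  truncation only replaces values by 0.\<close>

lemma abs_K_op_le:
  assumes "proper_cdf F" "H \<in> borel_measurable borel" "\<And>x. \<bar>H x\<bar> \<le> C"
  shows "\<bar>K_op F H x\<bar> \<le> C"
proof -
  interpret real_distribution "interval_measure F"
    by (rule real_distribution_proper_cdf[OF assms(1)])
  have "\<bar>cdf_conv H F x\<bar> \<le> (LINT y|interval_measure F. \<bar>H (x - y)\<bar>)"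
    unfolding cdf_conv_def by (rule integral_abs_bound)
  also have "\<dots> \<le> (LINT y|interval_measure F. C)"
    by (intro integral_mono integrable_abs integrable_bounded_borel[OF assms]) (auto simp: assms(3))
  finally have "\<bar>cdf_conv H F x\<bar> \<le> C" by (simp add: prob_space[unfolded space_eq_univ])
  then show ?thesis
    by (auto simp: K_op_def split: split_indicator)
qed

lemma K_op_diff:
  assumes "proper_cdf F"
    and "H \<in> borel_measurable borel" "\<And>x. \<bar>H x\<bar> \<le> B"
    and "G \<in> borel_measurable borel" "\<And>x. \<bar>G x\<bar> \<le> C"
  shows "K_op F (\<lambda>x. H x - G x) x = K_op F H x - K_op F G x"
  using integrable_bounded_borel[OF assms(1-3)] integrable_bounded_borel[OF assms(1,4,5)]
  by (simp add: K_op_def cdf_conv_def left_diff_distrib)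

text \<open>Sum and integral may be exchanged because the integrals of
  \<open>\<bar>f j\<bar>\<close> are at most \<open>b j\<close> under a probability measure, hence
  summable.\<close>

lemma K_op_suminf:
  assumes F: "proper_cdf F" and f [measurable]: "\<And>j. f j \<in> borel_measurable borel"
    and bound: "\<And>j x. \<bar>f j x\<bar> \<le> b j" and "summable b"
  shows "K_op F (\<lambda>x. \<Sum>j. f j x) x = (\<Sum>j. K_op F (f j) x)"
proof -
  interpret real_distribution "interval_measure F"
    by (rule real_distribution_proper_cdf[OF F])
  have summable_abs: "summable (\<lambda>j. \<bar>f j x\<bar>)" for x
    using bound by (intro summable_comparison_test[OF _ \<open>summable b\<close>]) auto
  have int: "integrable (interval_measure F) (\<lambda>y. f j (x - y))" for j
    by (rule integrable_bounded_borel[OF F f bound])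
  have "(LINT y|interval_measure F. \<bar>f j (x - y)\<bar>) \<le> (LINT y|interval_measure F. b j)" for j
    by (intro integral_mono integrable_abs int) (auto simp: bound)
  then have le: "(LINT y|interval_measure F. \<bar>f j (x - y)\<bar>) \<le> b j" for j
    by (simp add: prob_space[unfolded space_eq_univ])
  have sums: "(\<lambda>j. (LINT y|interval_measure F. f j (x - y))) sums
      (LINT y|interval_measure F. (\<Sum>j. f j (x - y)))"
    using int summable_abs le
    by (intro sums_integral summable_comparison_test[OF _ \<open>summable b\<close>]) auto
  from sums_mult2[OF sums, of "indicator {0..} x"] show ?thesis
    unfolding K_op_def cdf_conv_def by (rule sums_unique)
qed

section \<open>Bounded solutions\<close>

lemma bounded_solution_unique:
  assumes "0 < q" "q < 1" and F: "proper_cdf F"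
    and H: "bounded_solution q F H" and G: "bounded_solution q F G"
  shows "H = G"
proof
  fix x
  obtain B where B: "\<And>x. \<bar>H x\<bar> \<le> B"
    using H unfolding bounded_solution_def bounded_iff by (metis rangeI real_norm_def)
  obtain C where C: "\<And>x. \<bar>G x\<bar> \<le> C"
    using G unfolding bounded_solution_def bounded_iff by (metis rangeI real_norm_def)
  have meas [measurable]: "H \<in> borel_measurable borel" "G \<in> borel_measurable borel"
    using H G by (auto simp: bounded_solution_def)
  \<comment> \<open>The forcing terms cancel, so the difference \<open>D\<close> satisfies
    \<open>D = (1 - q) * K_op F D\<close>; each use of this gains a factor \<open>1 - q\<close> over
    the initial bound \<open>B + C\<close>.\<close>
  have le: "\<bar>H x - G x\<bar> \<le> (1 - q) ^ n * (B + C)" for n x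
  proof (induction n arbitrary: x)
    case 0
    show ?case using B[of x] C[of x] by simp
  next
    case (Suc n)
    have "H x - G x = (1 - q) * (K_op F H x - K_op F G x)"
      using H G unfolding bounded_solution_def by (metis add_diff_cancel_left right_diff_distrib)
    also have "\<dots> = (1 - q) * K_op F (\<lambda>x. H x - G x) x"
      using K_op_diff[OF F meas(1) B meas(2) C] by simp
    finally have "\<bar>H x - G x\<bar> = (1 - q) * \<bar>K_op F (\<lambda>x. H x - G x) x\<bar>"
      using \<open>q < 1\<close> by (simp add: abs_mult)
    also have "\<dots> \<le> (1 - q) * ((1 - q) ^ n * (B + C))"
      using \<open>q < 1\<close> by (intro mult_left_mono abs_K_op_le[OF F _ Suc.IH]) auto
    finally show ?case by (simp add: mult.assoc)
  qed
  have "(\<lambda>n. (1 - q) ^ n * (B + C)) \<longlonglongrightarrow> 0"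
    using assms(1,2) by (intro tendsto_mult_left_zero LIMSEQ_power_zero) auto
  then have "\<bar>H x - G x\<bar> \<le> 0"
    by (rule LIMSEQ_le_const) (use le in auto)
  then show "H x = G x" by simp
qed

section \<open>The geometric mixture of the iterates\<close>

lemma geometric_sums_1:
  fixes q :: real
  assumes "0 < q" "q < 1"
  shows "(\<lambda>j. q * (1 - q) ^ j) sums 1"
  using sums_mult[OF geometric_sums[of "1 - q"], of q] assms by simp

text \<open>The geometric weights dominate the terms uniformly in \<open>x\<close>, as required for
  exchanging the series with limits and with the operator.\<close>

lemma series_cdf_term_bound:
  assumes "0 < q" "q < 1" "proper_cdf F"
  shows "\<bar>q * (1 - q) ^ j * (K_op F ^^ j) (indicator {0..}) x\<bar> \<le> q * (1 - q) ^ j"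
  using abs_proper_cdf_le_1[OF proper_cdf_K_op_power[OF assms(3)], of j x] assms
  by (simp add: abs_mult mult_left_le)

lemma summable_series_cdf:
  assumes "0 < q" "q < 1" "proper_cdf F"
  shows "summable (\<lambda>j. q * (1 - q) ^ j * (K_op F ^^ j) (indicator {0..}) x)"
  using series_cdf_term_bound[OF assms]
  by (intro summable_comparison_test[OF _ sums_summable[OF geometric_sums_1[OF assms(1,2)]]]) auto

text \<open>Tannery's theorem. The filter is left general so that right-continuity and both limits
  at infinity are instances.\<close>

lemma tendsto_series_cdf:
  assumes "0 < q" "q < 1" "proper_cdf F" "A \<noteq> bot"
    and "\<And>j. ((K_op F ^^ j) (indicator {0..}) \<longlongrightarrow> l j) A"
  shows "(series_cdf q F \<longlongrightarrow> (\<Sum>j. q * (1 - q) ^ j * l j)) A"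
proof -
  have "((\<lambda>x. \<Sum>j. q * (1 - q) ^ j * (K_op F ^^ j) (indicator {0..}) x)
      \<longlongrightarrow> (\<Sum>j. q * (1 - q) ^ j * l j)) A"
    using series_cdf_term_bound[OF assms(1-3)]
    by (intro tannerys_theorem[where M = "\<lambda>j. q * (1 - q) ^ j", THEN conjunct2, THEN conjunct2]
        tendsto_mult_left assms(4,5) sums_summable[OF geometric_sums_1[OF assms(1,2)]])
       (simp add: case_prod_unfold)
  then show ?thesis by (simp add: series_cdf_def[abs_def])
qed

lemma proper_cdf_series_cdf:
  assumes "0 < q" "q < 1" "proper_cdf F"
  shows "proper_cdf (series_cdf q F)"
proof -
  have K: "mono ((K_op F ^^ j) (indicator {0..}))"
    "((K_op F ^^ j) (indicator {0..}) \<longlongrightarrow> (K_op F ^^ j) (indicator {0..}) a) (at_right a)"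
    "((K_op F ^^ j) (indicator {0..}) \<longlongrightarrow> 0) at_bot"
    "((K_op F ^^ j) (indicator {0..}) \<longlongrightarrow> 1) at_top" for j a
    using proper_cdf_K_op_power[OF assms(3), of j]
    by (auto simp: proper_cdf_def continuous_within)
  have "mono (series_cdf q F)"
    unfolding series_cdf_def[abs_def] using assms(1,2)
    by (intro monoI suminf_le mult_left_mono monoD[OF K(1)] summable_series_cdf[OF assms]) auto
  moreover have "continuous (at_right a) (series_cdf q F)" for a
    using tendsto_series_cdf[OF assms _ K(2), of a]
    by (simp add: continuous_within series_cdf_def)
  moreover have "(series_cdf q F \<longlongrightarrow> 0) at_bot"
    using tendsto_series_cdf[OF assms _ K(3)] by simp
  moreover have "(series_cdf q F \<longlongrightarrow> 1) at_top"
    using tendsto_series_cdf[OF assms _ K(4)] sums_unique[OF geometric_sums_1[OF assms(1,2)]] by simp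
  ultimately show ?thesis
    by (auto simp: proper_cdf_def)
qed

lemma bounded_solution_proper_cdf:
  assumes "proper_cdf H"
    and "\<And>x. H x = q * indicator {0..} x + (1 - q) * K_op F H x"
  shows "bounded_solution q F H"
  unfolding bounded_solution_def bounded_iff
  using assms borel_measurable_proper_cdf[OF assms(1)] abs_proper_cdf_le_1[OF assms(1)] by auto

lemma bounded_solution_series_cdf:
  assumes "0 < q" "q < 1" "proper_cdf F"
  shows "bounded_solution q F (series_cdf q F)"
proof (rule bounded_solution_proper_cdf[OF proper_cdf_series_cdf[OF assms]])
  fix x
  let ?K = "\<lambda>j. (K_op F ^^ j) (indicator {0..})"
  note [measurable] = borel_measurable_proper_cdf[OF proper_cdf_K_op_power[OF assms(3)]]
  have scale: "K_op F (\<lambda>x. c * H x) x = c * K_op F H x" for c H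
    by (simp add: K_op_def cdf_conv_def mult.assoc)
  have "(1 - q) * K_op F (series_cdf q F) x =
      (1 - q) * (\<Sum>j. K_op F (\<lambda>x. q * (1 - q) ^ j * ?K j x) x)"
    unfolding series_cdf_def[abs_def]
    by (subst K_op_suminf[OF assms(3) _ series_cdf_term_bound[OF assms]])
       (simp_all only: sums_summable[OF geometric_sums_1[OF assms(1,2)]], measurable)
  also have "(\<lambda>j. K_op F (\<lambda>x. q * (1 - q) ^ j * ?K j x) x) = (\<lambda>j. q * (1 - q) ^ j * ?K (Suc j) x)"
    by (simp add: scale)
  also have "(1 - q) * (\<Sum>j. q * (1 - q) ^ j * ?K (Suc j) x) = (\<Sum>j. q * (1 - q) ^ Suc j * ?K (Suc j) x)"
  proof -
    \<comment> \<open>This is the tail of the summable series; dividing by the nonzero factor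
      \<open>1 - q\<close> gives summability of the series to be scaled.\<close>
    have "summable (\<lambda>j. (1 - q) * (q * (1 - q) ^ j * ?K (Suc j) x))"
      using summable_Suc_iff[THEN iffD2, OF summable_series_cdf[OF assms, of x]]
      by (simp add: mult_ac)
    then have "summable (\<lambda>j. q * (1 - q) ^ j * ?K (Suc j) x)"
      using \<open>q < 1\<close> by (subst (asm) summable_cmult_iff) auto
    from suminf_mult[OF this, of "1 - q"] show ?thesis by (simp add: mult_ac)
  qed
  \<comment> \<open>The shifted series lacks exactly the term at index 0, which is the forcing term
    of the equation.\<close>
  also have "\<dots> = series_cdf q F x - q * indicator {0..} x"
    using suminf_split_head[OF summable_series_cdf[OF assms, of x]] by (simp add: series_cdf_def)
  finally show "series_cdf q F x = q * indicator {0..} x + (1 - q) * K_op F (series_cdf q F) x"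
    by simp
qed

section \<open>The stationary distribution\<close>

text \<open>The law after one step from initial law \<open>\<mu>\<close>. The product space makes
  the current state independent of the pair \<open>X 0\<close>, \<open>Z 1\<close>.\<close>

definition next_law ::
  "'a measure \<Rightarrow> (nat \<Rightarrow> 'a \<Rightarrow> real) \<Rightarrow> (nat \<Rightarrow> 'a \<Rightarrow> real) \<Rightarrow> real measure \<Rightarrow> real measure" where
  "next_law M X Z \<mu> = distr (\<mu> \<Otimes>\<^sub>M M) borel (\<lambda>(w, \<omega>). Z 1 \<omega> * max 0 (w + X 0 \<omega>))"

context resetting_waiting_chain
begin

lemma random_variables [measurable]:
  "random_variable borel (X 0)" "random_variable borel (Z 1)" "random_variable borel (Z (Suc 0))"
  using indep_vars_def2[THEN iffD1, OF indep, THEN conjunct1, THEN bspec, of "Increment 0"]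
    indep_vars_def2[THEN iffD1, OF indep, THEN conjunct1, THEN bspec, of "Reset 1"]
  by simp_all

text \<open>Split on the reset variable: a reset sends the state to 0, and otherwise the event says
  that \<open>X 0\<close> is at most \<open>x - w\<close> and \<open>x\<close> is
  nonnegative.\<close>

lemma prob_step_le:
  "prob {\<omega> \<in> space M. Z 1 \<omega> * max 0 (w + X 0 \<omega>) \<le> x} =
    q * indicator {0..} x + (1 - q) * (F (x - w) * indicator {0..} x)"
proof -
  let ?Y = "\<lambda>i. case i of Initial \<Rightarrow> W 0 | Increment n \<Rightarrow> X n | Reset n \<Rightarrow> Z n"
  let ?A = "{\<omega> \<in> space M. Z 1 \<omega> = 0 \<and> 0 \<le> x}"
  let ?B = "{\<omega> \<in> space M. Z 1 \<omega> = 1 \<and> X 0 \<omega> \<le> x - w \<and> 0 \<le> x}"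
  \<comment> \<open>The two masses add up to 1, so \<open>Z 1\<close> takes other values only on a
    null set.\<close>
  have "prob ({\<omega> \<in> space M. Z 1 \<omega> = 0} \<union> {\<omega> \<in> space M. Z 1 \<omega> = 1}) = q + (1 - q)"
    by (subst finite_measure_Union) (auto simp: reset_prob_0 reset_prob_1)
  then have "AE \<omega> in M. \<omega> \<in> {\<omega> \<in> space M. Z 1 \<omega> = 0} \<union> {\<omega> \<in> space M. Z 1 \<omega> = 1}"
    by (subst prob_eq_1[symmetric]) auto
  then have "prob {\<omega> \<in> space M. Z 1 \<omega> * max 0 (w + X 0 \<omega>) \<le> x} = prob (?A \<union> ?B)"
    by (intro finite_measure_eq_AE) (auto elim!: eventually_mono)
  also have "\<dots> = prob ?A + prob ?B"
    by (rule finite_measure_Union) auto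
  also have "prob ?A = q * indicator {0..} x"
    using reset_prob_0[of 1] by (simp split: split_indicator)
  also have "prob ?B = (1 - q) * (F (x - w) * indicator {0..} x)"
  proof -
    \<comment> \<open>Independence of \<open>X 0\<close> and \<open>Z 1\<close>, with test set
      \<open>{..x - w}\<close> for the increment and \<open>{1}\<close> for the reset
      variable.\<close>
    have "prob (\<Inter>i\<in>{Increment 0, Reset 1}. ?Y i -` (case i of Increment n \<Rightarrow> {..x - w} | _ \<Rightarrow> {1}) \<inter> space M) =
        (\<Prod>i\<in>{Increment 0, Reset 1}. prob (?Y i -` (case i of Increment n \<Rightarrow> {..x - w} | _ \<Rightarrow> {1}) \<inter> space M))"
      by (rule indep_varsD[OF indep]) auto
    then have "prob {\<omega> \<in> space M. Z 1 \<omega> = 1 \<and> X 0 \<omega> \<le> x - w} =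
        prob {\<omega> \<in> space M. Z 1 \<omega> = 1} * prob (X 0 -` {..x - w} \<inter> space M)"
      by (simp add: vimage_def Int_def mult.commute conj_ac)
    also have "prob (X 0 -` {..x - w} \<inter> space M) = F (x - w)"
      by (simp add: increment_cdf[of 0, symmetric] cdf_def measure_distr)
    finally show ?thesis
      using reset_prob_1[of 1] by (simp split: split_indicator)
  qed
  finally show ?thesis .
qed

lemma real_distribution_next_law:
  assumes "real_distribution \<mu>"
  shows "real_distribution (next_law M X Z \<mu>)"
proof -
  interpret \<mu>: real_distribution \<mu> by fact
  interpret pair_prob_space \<mu> M ..
  show ?thesis
    unfolding next_law_def by (rule P.real_distribution_distr) measurable
qed

text \<open>Slicing the product measure at a fixed state \<open>w\<close> yields the transition
  kernel at \<open>w\<close>.\<close>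

lemma emeasure_next_law:
  assumes "real_distribution \<mu>" and A [measurable]: "A \<in> sets borel"
  shows "emeasure (next_law M X Z \<mu>) A = (\<integral>\<^sup>+ w. emeasure (transition_law M X Z w) A \<partial>\<mu>)"
proof -
  interpret \<mu>: real_distribution \<mu> by fact
  show ?thesis
    unfolding next_law_def transition_law_def
    by (subst emeasure_distr, measurable)
       (auto simp: emeasure_pair_measure_alt emeasure_distr space_pair_measure
         intro!: nn_integral_cong arg_cong[where f="emeasure M"])
qed

text \<open>Averaging the one-step probabilities over \<open>\<mu>\<close> produces \<open>F\<close>
  integrated against \<open>\<mu>\<close>; commutativity of convolution turns this into the integral
  against \<open>F\<close> used by \<open>K_op\<close>.\<close>

lemma cdf_next_law:
  assumes F: "proper_cdf F" and \<mu>: "real_distribution \<mu>"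
  shows "cdf (next_law M X Z \<mu>) x = q * indicator {0..} x + (1 - q) * K_op F (cdf \<mu>) x"
proof -
  interpret \<mu>: real_distribution \<mu> by fact
  interpret N: real_distribution "next_law M X Z \<mu>" by (rule real_distribution_next_law[OF \<mu>])
  note [measurable] = borel_measurable_proper_cdf[OF F]
  let ?p = "\<lambda>w. q * indicator {0..} x + (1 - q) * (F (x - w) * indicator {0..} x)"
  have p: "emeasure (transition_law M X Z w) {..x} = ennreal (?p w)" for w
    unfolding transition_law_def
    by (subst emeasure_distr)
       (auto simp: emeasure_eq_measure prob_step_le[symmetric] intro!: arg_cong[where f=prob])
  have p_nonneg: "0 \<le> ?p w" for w
    by (subst prob_step_le[symmetric]) simp
  have int: "integrable \<mu> (\<lambda>w. F (x - w))"
    by (rule \<mu>.integrable_const_bound[where B=1]) (auto simp: abs_proper_cdf_le_1[OF F])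
  have "ennreal (cdf (next_law M X Z \<mu>) x) = (\<integral>\<^sup>+ w. ennreal (?p w) \<partial>\<mu>)"
    unfolding cdf_def N.emeasure_eq_measure[symmetric]
    by (subst emeasure_next_law[OF \<mu>]) (auto simp: p)
  also have "\<dots> = ennreal (LINT w|\<mu>. ?p w)"
    using int by (intro nn_integral_eq_integral AE_I2 p_nonneg) auto
  finally have "cdf (next_law M X Z \<mu>) x = (LINT w|\<mu>. ?p w)"
    by (subst (asm) ennreal_inj) (auto simp: N.cdf_nonneg p_nonneg intro!: integral_nonneg_AE)
  also have "\<dots> = q * indicator {0..} x + (1 - q) * ((LINT w|\<mu>. F (x - w)) * indicator {0..} x)"
    using int by (simp add: \<mu>.prob_space[unfolded \<mu>.space_eq_univ])
  also have "(LINT w|\<mu>. F (x - w)) = cdf_conv F (cdf \<mu>) x"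
    by (simp add: cdf_conv_def interval_measure_cdf[OF \<mu>])
  also have "\<dots> = cdf_conv (cdf \<mu>) F x"
    by (simp add: cdf_conv_commute[OF F proper_cdf_cdf[OF \<mu>]])
  finally show ?thesis by (simp add: K_op_def)
qed

text \<open>Stationarity says that \<open>\<mu>\<close> is a fixed point of
  \<open>next_law M X Z\<close>, and this equality of laws can be tested on CDFs.\<close>

lemma stationary_distribution_iff:
  assumes F: "proper_cdf F"
  shows "stationary_distribution M X Z \<mu> \<longleftrightarrow>
    real_distribution \<mu> \<and> measure \<mu> {0..} = 1 \<and> bounded_solution q F (cdf \<mu>)"
proof (cases "real_distribution \<mu>")
  case True
  note N = real_distribution_next_law[OF True]
  interpret \<mu>: real_distribution \<mu> by fact
  interpret N: real_distribution "next_law M X Z \<mu>" by fact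
  have "(\<forall>A\<in>sets borel. emeasure \<mu> A = (\<integral>\<^sup>+ w. emeasure (transition_law M X Z w) A \<partial>\<mu>)) \<longleftrightarrow>
      (\<forall>A\<in>sets borel. emeasure \<mu> A = emeasure (next_law M X Z \<mu>) A)"
    by (simp add: emeasure_next_law[OF True])
  also have "\<dots> \<longleftrightarrow> \<mu> = next_law M X Z \<mu>"
    by (metis N.events_eq_borel \<mu>.events_eq_borel measure_eqI)
  also have "\<dots> \<longleftrightarrow> cdf \<mu> = cdf (next_law M X Z \<mu>)"
    using cdf_unique[OF True N] by metis
  also have "\<dots> \<longleftrightarrow> bounded_solution q F (cdf \<mu>)"
    using bounded_solution_proper_cdf[OF proper_cdf_cdf[OF True], of q F]
    by (auto simp: fun_eq_iff cdf_next_law[OF F True] bounded_solution_def)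
  finally show ?thesis
    using True by (simp add: stationary_distribution_def)
qed (simp add: stationary_distribution_def)

end

text \<open>The mass of the negative half-line is the left limit of the CDF at 0.\<close>

lemma measure_nonneg_eq_1:
  assumes "real_distribution \<mu>" and "\<And>x. x < 0 \<Longrightarrow> cdf \<mu> x = 0"
  shows "measure \<mu> {0..} = 1"
proof -
  interpret real_distribution \<mu> by fact
  have "(cdf \<mu> \<longlongrightarrow> 0) (at_left 0)"
    using assms(2) by (intro tendsto_eventually) (auto simp: eventually_at_filter)
  then have "measure \<mu> {..<0} = 0"
    using tendsto_unique[OF _ cdf_at_left[of 0]] by auto
  then show ?thesis
    using prob_compl[of "{..<0}"] by (simp add: Compl_eq_Diff_UNIV[symmetric])
qed

theorem theorem4p1:
  fixes q :: real and F :: "real \<Rightarrow> real"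
    and M :: "'a measure" and W X Z :: "nat \<Rightarrow> 'a \<Rightarrow> real"
  assumes "0 < q" and "q < 1" and "proper_cdf F"
  shows "(\<exists>!H. bounded_solution q F H) \<and>
    (\<forall>x. summable (\<lambda>j. q * (1 - q) ^ j * (K_op F ^^ j) (indicator {0..}) x)) \<and>
    proper_cdf (series_cdf q F) \<and>
    bounded_solution q F (series_cdf q F) \<and>
    (resetting_waiting_chain M q F W X Z \<longrightarrow>
      (\<exists>!\<mu>. stationary_distribution M X Z \<mu>) \<and>
      (\<forall>\<mu>. stationary_distribution M X Z \<mu> \<longrightarrow>
        bounded_solution q F (cdf \<mu>) \<and>
        cdf \<mu> = series_cdf q F \<and>
        (\<forall>x. (\<lambda>j. q * (1 - q) ^ j * expansion_factor F j x) sums cdf \<mu> x)))"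
proof (intro conjI allI impI)
  note unique = bounded_solution_unique[OF assms]
  note series_solution = bounded_solution_series_cdf[OF assms]
  note series_proper = proper_cdf_series_cdf[OF assms]
  show "\<exists>!H. bounded_solution q F H"
    using series_solution unique by blast
  show "summable (\<lambda>j. q * (1 - q) ^ j * (K_op F ^^ j) (indicator {0..}) x)" for x
    by (rule summable_series_cdf[OF assms])
  show "proper_cdf (series_cdf q F)" by (rule series_proper)
  show "bounded_solution q F (series_cdf q F)" by (rule series_solution)
  assume "resetting_waiting_chain M q F W X Z"
  then interpret resetting_waiting_chain M q F W X Z .
  note stationary_iff = stationary_distribution_iff[OF assms(3)]
  have series: "cdf \<mu> = series_cdf q F" if "stationary_distribution M X Z \<mu>" for \<mu>
    using that unique[OF _ series_solution] by (simp add: stationary_iff)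
  let ?\<mu> = "interval_measure (series_cdf q F)"
  have cdf: "cdf ?\<mu> = series_cdf q F"
    by (rule cdf_interval_measure_proper_cdf[OF series_proper])
  \<comment> \<open>Both terms of the equation carry the indicator, so a solution vanishes at
    negative \<open>x\<close>; hence the law \<open>?\<mu>\<close> lives on the state space.\<close>
  have "series_cdf q F x = 0" if "x < 0" for x
    using series_solution that by (simp add: bounded_solution_def K_op_def)
  then have "stationary_distribution M X Z ?\<mu>"
    unfolding stationary_iff using real_distribution_proper_cdf[OF series_proper] series_solution
    by (auto simp: cdf intro!: measure_nonneg_eq_1)
  then show "\<exists>!\<mu>. stationary_distribution M X Z \<mu>"
    \<comment> \<open>Every stationary law has CDF \<open>series_cdf q F\<close>, and a law is
      determined by its CDF.\<close>
    by (rule ex1I) (metis cdf cdf_unique real_distribution_proper_cdf series series_proper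
        stationary_iff)
  fix \<mu> assume \<mu>: "stationary_distribution M X Z \<mu>"
  show "bounded_solution q F (cdf \<mu>)" using \<mu> by (simp add: stationary_iff)
  show "cdf \<mu> = series_cdf q F" by (rule series[OF \<mu>])
  show "(\<lambda>j. q * (1 - q) ^ j * expansion_factor F j x) sums cdf \<mu> x" for x
    using summable_sums[OF summable_series_cdf[OF assms, of x]]
    by (simp add: expansion_factor_eq[OF assms(3)] series[OF \<mu>] series_cdf_def)
qed

end
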